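(* For every integer $n\geq 9$, \[\left\lceil\log_3 n\right\rceil+2\le \operatorname{aw}([n],3) \le \left\lceil\log_2 n \right\rceil +1 .\] Moreover, $\operatorname{aw}([n],3)=\left\lceil\log_3n\right\rceil+2$ for $n\in\{3,4,5,6,7\}$ and $\operatorname{aw}([8],3)=5$.
   Context: $[n]=\{1,\dots,n\}$. For a finite nonempty subset $S$ of the integers and $k\ge 2$, a $k$-term arithmetic progression ($k$-AP) in $S$ is a set of $k$ distinct elements of $S$ of the form $a,a+d,\dots,a+(k-1)d$ with $d\ge 1$. An $r$-coloring of $S$ is a function $c:S\to\{1,\dots,r\}$; it is exact if $c$ is surjective. A $k$-AP is rainbow under $c$ if its $k$ elements receive $k$ distinct colors. The anti-van der Waerden number $\operatorname{aw}(S,k)$ is the smallest $r$ such that every exact $r$-coloring of $S$ contains a rainbow $k$-AP; by convention $\operatorname{aw}(S,k)=|S|+1$ when $|S|<k$. *)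

theory Defs
  imports Complex_Main "HOL-Library.FuncSet"
begin

definition is_AP :: "nat \<Rightarrow> int set \<Rightarrow> int set \<Rightarrow> bool" where
  "is_AP k S A \<longleftrightarrow> A \<subseteq> S \<and> (\<exists>a d. d \<ge> 1 \<and> A = {a + int i * d | i. i < k})"

definition exact_coloring :: "nat \<Rightarrow> int set \<Rightarrow> (int \<Rightarrow> nat) \<Rightarrow> bool" where
  "exact_coloring r S c \<longleftrightarrow> c \<in> S \<rightarrow> {1..r} \<and> c ` S = {1..r}"

definition rainbow :: "(int \<Rightarrow> nat) \<Rightarrow> int set \<Rightarrow> bool" where
  "rainbow c A \<longleftrightarrow> inj_on c A"

text \<open>
  The bound \<open>1 \<le> r\<close> matters: a nonempty set has no coloring with \<open>0\<close> colors, so \<open>r = 0\<close> would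
  satisfy the condition vacuously.
\<close>

definition aw :: "int set \<Rightarrow> nat \<Rightarrow> nat" where
  "aw S k = (if card S < k then card S + 1
     else (LEAST r. 1 \<le> r \<and>
            (\<forall>c. exact_coloring r S c \<longrightarrow> (\<exists>A. is_AP k S A \<and> rainbow c A))))"

end

theory Submission
  imports Defs
begin

text \<open>
  Upper bound: shrink the interval until its two endpoint colors occur only once. The midpoint
  excludes odd length, and reflecting through points of the right half (\<open>2 x - q\<close>, \<open>x\<close>, \<open>q\<close> is a
  progression whose last color is unique) shows that the left half carries every color except that
  of \<open>q\<close>. Halving the interval thus costs one color, and the count for length at most \<open>16\<close> is
  improved by one by a direct look at the classes forced by both endpoints.

  Lower bound: color \<open>x\<close> by the 3-adic valuation of \<open>x - 1\<close>, with \<open>x = 1\<close> getting its own color.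
  Three terms of a progression satisfy \<open>x + z = 2 y\<close>, so two of the valuations agree.
\<close>

section \<open>Rainbow-free colorings and their relation to \<open>aw\<close>\<close>

definition rainbow_free :: "(int \<Rightarrow> 'a) \<Rightarrow> int set \<Rightarrow> bool" where
  "rainbow_free c S \<longleftrightarrow>
    (\<forall>x\<in>S. \<forall>y\<in>S. \<forall>z\<in>S. x + z = 2 * y \<longrightarrow> c x = c y \<or> c y = c z \<or> c x = c z)"

lemma rainbow_freeD:
  "\<lbrakk>rainbow_free c S; x + z = 2 * y; x \<in> S; y \<in> S; z \<in> S\<rbrakk>
    \<Longrightarrow> c x = c y \<or> c y = c z \<or> c x = c z"
  unfolding rainbow_free_def by blast

lemma rainbow_free_subset: "rainbow_free c S \<Longrightarrow> T \<subseteq> S \<Longrightarrow> rainbow_free c T"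
  unfolding rainbow_free_def by blast

lemma rainbow_free_comp: "rainbow_free c S \<Longrightarrow> rainbow_free (\<lambda>x. f (c x)) S"
  unfolding rainbow_free_def by metis

lemma AP_3_set: "{a + int i * d | i. i < 3} = {a, a + d, a + 2 * d}"
proof -
  have "{i::nat. i < 3} = {0, 1, 2}" by auto
  moreover have "{a + int i * d | i. i < 3} = (\<lambda>i. a + int i * d) ` {i. i < 3}" by auto
  ultimately show ?thesis by simp
qed

text \<open>The equation \<open>x + z = 2 * y\<close> also admits decreasing triples, which reverse
  to progressions, and constant ones, where the conclusion is trivial.\<close>

lemma rainbow_free_iff: "rainbow_free c S \<longleftrightarrow> (\<nexists>A. is_AP 3 S A \<and> rainbow c A)"
proof
  assume rf: "rainbow_free c S"
  show "\<nexists>A. is_AP 3 S A \<and> rainbow c A"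
  proof
    assume "\<exists>A. is_AP 3 S A \<and> rainbow c A"
    then obtain a d where d: "d \<ge> 1" and sub: "{a, a + d, a + 2 * d} \<subseteq> S"
      and inj: "inj_on c {a, a + d, a + 2 * d}"
      unfolding is_AP_def rainbow_def AP_3_set by blast
    have "c a = c (a + d) \<or> c (a + d) = c (a + 2 * d) \<or> c a = c (a + 2 * d)"
      using sub by (intro rainbow_freeD[OF rf]) auto
    then show False using d inj by (auto simp: inj_on_def)
  qed
next
  assume no: "\<nexists>A. is_AP 3 S A \<and> rainbow c A"
  have ordered: "c x = c y \<or> c y = c z \<or> c x = c z"
    if "x \<in> S" "y \<in> S" "z \<in> S" "x + z = 2 * y" "x < y" for x y z
  proof (rule ccontr)
    assume "\<not> ?thesis"
    then have "rainbow c {x, y, z}" by (auto simp: rainbow_def inj_on_def)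
    moreover have "is_AP 3 S {x, y, z}"
      unfolding is_AP_def AP_3_set
    proof (intro conjI exI)
      show "{x, y, z} = {x, x + (y - x), x + 2 * (y - x)}" using that by auto
    qed (use that in auto)
    ultimately show False using no by blast
  qed
  show "rainbow_free c S"
    unfolding rainbow_free_def
  proof (intro ballI impI)
    fix x y z assume *: "x \<in> S" "y \<in> S" "z \<in> S" "x + z = 2 * y"
    consider "x < y" | "x = y" | "z < y" using *(4) by linarith
    then show "c x = c y \<or> c y = c z \<or> c x = c z"
    proof cases
      case 3
      then show ?thesis using ordered[of z y x] * by (auto simp: add.commute)
    qed (use ordered[of x y z] * in auto)
  qed
qed

lemma aw_3_le:
  fixes n :: int
  assumes "n \<ge> 3"
    and bound: "\<And>c::int \<Rightarrow> nat. rainbow_free c {1..n} \<Longrightarrow> card (c ` {1..n}) \<le> k"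
  shows "aw {1..n} 3 \<le> k + 1"
proof -
  have "\<exists>A. is_AP 3 {1..n} A \<and> rainbow c A" if "exact_coloring (k + 1) {1..n} c" for c
  proof (rule ccontr)
    assume "\<not> ?thesis"
    then have "card (c ` {1..n}) \<le> k" by (intro bound) (simp add: rainbow_free_iff)
    then show False using that by (simp add: exact_coloring_def)
  qed
  then have "(LEAST r. 1 \<le> r \<and> (\<forall>c. exact_coloring r {1..n} c \<longrightarrow>
      (\<exists>A. is_AP 3 {1..n} A \<and> rainbow c A))) \<le> k + 1"
    by (intro Least_le) auto
  then show ?thesis using \<open>n \<ge> 3\<close> by (simp add: aw_def)
qed

text \<open>Merges all colors from \<open>s\<close> upwards. Merging creates no rainbow progression,
  so a rainbow-free exact coloring with \<open>r\<close> colors yields one for every smaller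
  positive number of colors.\<close>

lemma exact_coloring_min:
  assumes "exact_coloring r S c" "1 \<le> s" "s \<le> r"
  shows "exact_coloring s S (\<lambda>x. min (c x) s)"
proof -
  have "(\<lambda>x. min (c x) s) ` S = (\<lambda>i. min i s) ` (c ` S)" by (simp add: image_image)
  also have "c ` S = {1..r}" using assms(1) by (simp add: exact_coloring_def)
  also have "(\<lambda>i. min i s) ` {1..r} = {1..s}"
  proof
    show "{1..s} \<subseteq> (\<lambda>i. min i s) ` {1..r}"
    proof
      fix i assume "i \<in> {1..s}"
      then have "i = min i s" "i \<in> {1..r}" using assms(3) by auto
      then show "i \<in> (\<lambda>i. min i s) ` {1..r}" by (rule image_eqI)
    qed
  qed (use assms(2) in auto)
  finally show ?thesis by (auto simp: exact_coloring_def)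
qed

lemma less_aw_3:
  fixes n :: int
  assumes "n \<ge> 3" and ex: "exact_coloring r {1..n} c" and rf: "rainbow_free c {1..n}"
  shows "r < aw {1..n} 3"
proof -
  let ?P = "\<lambda>r. 1 \<le> r \<and> (\<forall>c. exact_coloring r {1..n} c \<longrightarrow>
      (\<exists>A. is_AP 3 {1..n} A \<and> rainbow c A))"
  \<comment> \<open>With more colors than points the condition holds vacuously, so the
    \<open>LEAST\<close> is attained.\<close>
  have "\<not> exact_coloring (nat n + 1) {1..n} c" for c
    using card_image_le[of "{1..n}" c] by (auto simp: exact_coloring_def)
  then have ex_P: "?P (nat n + 1)" by auto
  have aw: "aw {1..n} 3 = (LEAST r. ?P r)" using \<open>n \<ge> 3\<close> by (simp add: aw_def)
  have P: "?P (aw {1..n} 3)" unfolding aw by (rule LeastI[of ?P, OF ex_P])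
  show ?thesis
  proof (rule ccontr)
    assume "\<not> ?thesis"
    then have "aw {1..n} 3 \<le> r" by simp
    with P have "exact_coloring (aw {1..n} 3) {1..n} (\<lambda>x. min (c x) (aw {1..n} 3))"
      by (blast intro: exact_coloring_min[OF ex])
    moreover have "rainbow_free (\<lambda>x. min (c x) (aw {1..n} 3)) {1..n}"
      by (rule rainbow_free_comp[OF rf])
    ultimately show False using P unfolding rainbow_free_iff by blast
  qed
qed

section \<open>Lower bounds: the 3-adic coloring and a coloring of length 8\<close>

text \<open>This is \<open>1 + min t v\<close> for the 3-adic valuation \<open>v\<close> of
  \<open>x\<close>; the cutoff \<open>t\<close> gives \<open>0\<close> the top color.\<close>

fun val3_color :: "nat \<Rightarrow> int \<Rightarrow> nat" where
  "val3_color 0 x = 1"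
| "val3_color (Suc t) x = (if 3 dvd x then Suc (val3_color t (x div 3)) else 1)"

lemma val3_color_range: "val3_color t x \<in> {1..t + 1}"
proof (induction t arbitrary: x)
  case (Suc t)
  then show ?case using Suc.IH[of "x div 3"] by simp
qed simp

lemma val3_color_zero: "val3_color t 0 = t + 1"
  by (induction t) auto

lemma val3_color_power: "j \<le> t \<Longrightarrow> val3_color t (3 ^ j) = j + 1"
proof (induction t arbitrary: j)
  case (Suc t)
  then show ?case by (cases j) auto
qed auto

lemma val3_color_rainbow_free:
  "x + z = 2 * y \<Longrightarrow> val3_color t x = val3_color t y \<or>
     val3_color t y = val3_color t z \<or> val3_color t x = val3_color t z"
proof (induction t arbitrary: x y z)
  case (Suc t)
  \<comment> \<open>If 3 divides two of the terms, it divides the third. So either all three can be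
    divided by 3, or two of them are prime to 3 and share color \<open>1\<close>.\<close>
  consider "3 dvd x" "3 dvd y" "3 dvd z" | "\<not> 3 dvd x" "\<not> 3 dvd y"
    | "\<not> 3 dvd y" "\<not> 3 dvd z" | "\<not> 3 dvd x" "\<not> 3 dvd z"
  proof -
    have "3 dvd x \<and> 3 dvd y \<and> 3 dvd z \<or> \<not> 3 dvd x \<and> \<not> 3 dvd y \<or>
        \<not> 3 dvd y \<and> \<not> 3 dvd z \<or> \<not> 3 dvd x \<and> \<not> 3 dvd z"
      using Suc.prems by presburger
    then show ?thesis using that by blast
  qed
  then show ?case
  proof cases
    case 1
    then have "x div 3 + z div 3 = 2 * (y div 3)" using Suc.prems by presburger
    from Suc.IH[OF this] show ?thesis using 1 by simp
  qed simp_all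
qed simp

lemma aw_3_lower:
  fixes n :: int
  assumes "n \<ge> 3" "3 ^ t < n"
  shows "t + 3 \<le> aw {1..n} 3"
proof -
  \<comment> \<open>The shift sends \<open>1\<close> to \<open>0\<close>, which gets color
    \<open>t + 2\<close>; the points \<open>3 ^ j + 1\<close> with \<open>j \<le> t\<close> lie in
    the interval and supply the colors \<open>1\<close> to \<open>t + 1\<close>.\<close>
  let ?c = "\<lambda>x. val3_color (t + 1) (x - 1)"
  have "?c ` {1..n} = {1..t + 2}"
  proof
    show "?c ` {1..n} \<subseteq> {1..t + 2}" using val3_color_range[of "t + 1"]
      by (auto simp del: val3_color.simps)
    show "{1..t + 2} \<subseteq> ?c ` {1..n}"
    proof
      fix i assume i: "i \<in> {1..t + 2}"
      show "i \<in> ?c ` {1..n}"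
      proof (cases "i = t + 2")
        case True
        then show ?thesis using assms
          by (intro image_eqI[of _ _ 1]) (auto simp: val3_color_zero simp del: val3_color.simps)
      next
        case False
        then obtain j where j: "i = j + 1" "j \<le> t" using i by (cases i) auto
        then have "(3::int) ^ j \<le> 3 ^ t" by (intro power_increasing) auto
        then have "3 ^ j + 1 \<le> n" using assms by linarith
        then show ?thesis using j
          by (intro image_eqI[of _ _ "3 ^ j + 1"])
            (simp_all add: val3_color_power del: val3_color.simps)
      qed
    qed
  qed
  then have "exact_coloring (t + 2) {1..n} ?c" unfolding exact_coloring_def by blast
  moreover have "rainbow_free ?c {1..n}"
    unfolding rainbow_free_def by (intro ballI impI val3_color_rainbow_free) auto
  ultimately show ?thesis using less_aw_3[OF assms(1)] by fastforce
qed

text \<open>The 3-adic coloring yields only the bound 4 here. Instead, give \<open>1\<close> and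
  \<open>8\<close> unique colors: this forces exactly the classes \<open>{2, 3, 5}\<close> and
  \<open>{4, 6, 7}\<close>, and no progression contains both endpoints.\<close>

lemma five_le_aw_8: "5 \<le> aw {1..8} 3"
proof -
  let ?c = "\<lambda>x::int. if x = 1 then 1 else if x = 8 then 4 else if x \<in> {2, 3, 5} then 2 else 3::nat"
  have I: "{1..8} = {1, 2, 3, 4, 5, 6, 7, 8::int}" by auto
  have "exact_coloring 4 {1..8} ?c" unfolding exact_coloring_def I by auto
  moreover have "rainbow_free ?c {1..8}"
    unfolding rainbow_free_def
  proof (intro ballI impI)
    fix x y z :: int
    assume "x \<in> {1..8}" "y \<in> {1..8}" "z \<in> {1..8}" and "x + z = 2 * y"
    then have z: "z = 2 * y - x" and xy: "x \<in> {1..8}" "y \<in> {1..8}"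
      and "1 \<le> 2 * y - x" "2 * y - x \<le> 8" by simp_all
    show "?c x = ?c y \<or> ?c y = ?c z \<or> ?c x = ?c z"
      using xy \<open>1 \<le> 2 * y - x\<close> \<open>2 * y - x \<le> 8\<close> unfolding z I
      by (elim insertE emptyE) simp_all
  qed
  ultimately show ?thesis using less_aw_3[of 8 4 ?c] by simp
qed

section \<open>Upper bounds: unique endpoint colors and halving\<close>

lemma extremal_subinterval:
  fixes c :: "int \<Rightarrow> 'a"
  assumes "card (c ` {l..u}) \<ge> 2"
  shows "\<exists>p q. l \<le> p \<and> p < q \<and> q \<le> u \<and> c ` {p..q} = c ` {l..u} \<and>
    (\<forall>x. p < x \<longrightarrow> x \<le> q \<longrightarrow> c x \<noteq> c p) \<and> (\<forall>x. p \<le> x \<longrightarrow> x < q \<longrightarrow> c x \<noteq> c q)"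
  using assms
proof (induction "nat (u - l)" arbitrary: l u rule: less_induct)
  case less
  have lu: "l < u"
  proof (rule ccontr)
    assume "\<not> l < u"
    then have "{l..u} = {} \<or> {l..u} = {l}" by auto
    then show False using less.prems by auto
  qed
  consider x where "l < x" "x \<le> u" "c x = c l" | x where "l \<le> x" "x < u" "c x = c u"
    | "\<forall>x. l < x \<and> x \<le> u \<longrightarrow> c x \<noteq> c l" "\<forall>x. l \<le> x \<and> x < u \<longrightarrow> c x \<noteq> c u" by blast
  then show ?case
  proof cases
    case 1
    have "{l..u} = insert l {l + 1..u}" using lu by auto
    moreover have "c l \<in> c ` {l + 1..u}" using 1 by (intro image_eqI[of _ _ x]) auto
    ultimately have eq: "c ` {l + 1..u} = c ` {l..u}" by auto
    with less.hyps[of u "l + 1"] lu less.prems obtain p q where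
      "l + 1 \<le> p" "p < q" "q \<le> u" "c ` {p..q} = c ` {l..u}"
      "\<forall>x. p < x \<longrightarrow> x \<le> q \<longrightarrow> c x \<noteq> c p" "\<forall>x. p \<le> x \<longrightarrow> x < q \<longrightarrow> c x \<noteq> c q"
      by auto
    then show ?thesis by (intro exI[of _ p] exI[of _ q]) simp
  next
    case 2
    have "{l..u} = insert u {l..u - 1}" using lu by auto
    moreover have "c u \<in> c ` {l..u - 1}" using 2 by (intro image_eqI[of _ _ x]) auto
    ultimately have eq: "c ` {l..u - 1} = c ` {l..u}" by auto
    with less.hyps[of "u - 1" l] lu less.prems obtain p q where
      "l \<le> p" "p < q" "q \<le> u - 1" "c ` {p..q} = c ` {l..u}"
      "\<forall>x. p < x \<longrightarrow> x \<le> q \<longrightarrow> c x \<noteq> c p" "\<forall>x. p \<le> x \<longrightarrow> x < q \<longrightarrow> c x \<noteq> c q"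
      by auto
    then show ?thesis by (intro exI[of _ p] exI[of _ q]) simp
  next
    case 3
    then show ?thesis using lu by (intro exI[of _ l] exI[of _ u]) simp
  qed
qed

lemma colors_of_left_half:
  fixes c :: "int \<Rightarrow> 'a"
  assumes rf: "rainbow_free c {p..q}" and "p < q"
    and p: "\<And>x. \<lbrakk>p < x; x \<le> q\<rbrakk> \<Longrightarrow> c x \<noteq> c p"
    and q: "\<And>x. \<lbrakk>p \<le> x; x < q\<rbrakk> \<Longrightarrow> c x \<noteq> c q"
  obtains m where "m \<ge> 1" "q = p + 2 * m - 1" "c ` {p..q} = insert (c q) (c ` {p..p + m - 1})"
proof -
  have "odd (q - p)"
  proof
    assume "even (q - p)"
    then obtain k where k: "q - p = 2 * k" by (rule evenE)
    have "c p = c (p + k) \<or> c (p + k) = c q \<or> c p = c q"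
      using k \<open>p < q\<close> by (intro rainbow_freeD[OF rf]) auto
    then show False using p[of "p + k"] q[of "p + k"] p[of q] k \<open>p < q\<close> by auto
  qed
  then obtain j where j: "q - p = 2 * j + 1" by (elim oddE)
  define m where "m = j + 1"
  have m: "m \<ge> 1" "q = p + 2 * m - 1" using j \<open>p < q\<close> by (auto simp: m_def)
  \<comment> \<open>For \<open>x \<ge> p + m\<close> the point \<open>2 * x - q\<close> lies
    strictly between \<open>p\<close> and \<open>x\<close> and has the color of \<open>x\<close>. It
    may still be in the right half, hence the strong induction.\<close>
  have left: "c x \<in> c ` {p..p + m - 1}" if "p \<le> x" "x < q" for x
    using that
  proof (induction "nat (x - p)" arbitrary: x rule: less_induct)
    case less
    show ?case
    proof (cases "x \<le> p + m - 1")
      case False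
      have "c (2 * x - q) = c x \<or> c x = c q \<or> c (2 * x - q) = c q"
        using False m less.prems by (intro rainbow_freeD[OF rf]) auto
      then have "c (2 * x - q) = c x"
        using q[of x] q[of "2 * x - q"] False m less.prems by auto
      moreover have "c (2 * x - q) \<in> c ` {p..p + m - 1}"
        using False m less.prems by (intro less.hyps) auto
      ultimately show ?thesis by simp
    qed (use less.prems in auto)
  qed
  have "c ` {p..q} = insert (c q) (c ` {p..p + m - 1})"
  proof
    show "c ` {p..q} \<subseteq> insert (c q) (c ` {p..p + m - 1})"
    proof
      fix y assume "y \<in> c ` {p..q}"
      then obtain x where "p \<le> x" "x \<le> q" "y = c x" by auto
      then show "y \<in> insert (c q) (c ` {p..p + m - 1})"
        using left[of x] by (cases "x = q") auto
    qed
    show "insert (c q) (c ` {p..p + m - 1}) \<subseteq> c ` {p..q}" using m by auto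
  qed
  with m that show ?thesis by blast
qed

text \<open>
  The bound covers all lengths up to \<open>n\<close> because the maximal number of colors is not monotone in
  the length: it is \<open>4\<close> for length \<open>8\<close> but \<open>3\<close> for length \<open>9\<close>.
\<close>
definition max_colors_le :: "int \<Rightarrow> nat \<Rightarrow> bool" where
  "max_colors_le n k \<longleftrightarrow>
    (\<forall>(c::int \<Rightarrow> nat) l u. u - l < n \<longrightarrow> rainbow_free c {l..u} \<longrightarrow> card (c ` {l..u}) \<le> k)"

lemma max_colors_leD:
  "\<lbrakk>max_colors_le n k; rainbow_free c {l..u}; u - l < n\<rbrakk> \<Longrightarrow> card (c ` {l..u}) \<le> k"
  for c :: "int \<Rightarrow> nat"
  unfolding max_colors_le_def by blast

lemma max_colors_le_mono: "max_colors_le n k \<Longrightarrow> n' \<le> n \<Longrightarrow> max_colors_le n' k"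
  unfolding max_colors_le_def by auto

lemma max_colors_le_1: "max_colors_le 1 1"
  unfolding max_colors_le_def
proof (intro allI impI)
  fix c :: "int \<Rightarrow> nat" and l u :: int
  assume "u - l < 1"
  then have "{l..u} = {} \<or> {l..u} = {l}" by auto
  then show "card (c ` {l..u}) \<le> 1" by auto
qed

lemma card_le_left_half:
  fixes c :: "int \<Rightarrow> nat"
  assumes rf: "rainbow_free c {p..q}"
    and half: "max_colors_le m k" "q = p + 2 * m - 1" "m \<ge> 1"
    and eq: "c ` {p..q} = insert (c q) (c ` {p..p + m - 1})"
  shows "card (c ` {p..q}) \<le> k + 1"
proof -
  have "card (c ` {p..p + m - 1}) \<le> k"
    by (rule max_colors_leD[OF half(1) rainbow_free_subset[OF rf]]) (use half in auto)
  then show ?thesis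
    unfolding eq using card_insert_le_m1[of "k + 1" "c ` {p..p + m - 1}" "c q"] by simp
qed

text \<open>The shrunk interval has even length \<open>2 * m\<close>, at most \<open>n\<close>, so
  \<open>m \<le> n div 2\<close> also for odd \<open>n\<close>. Starting from length 1 this reaches
  3, 7 and 15.\<close>

lemma max_colors_le_double:
  assumes "max_colors_le (n div 2) k"
  shows "max_colors_le n (k + 1)"
  unfolding max_colors_le_def
proof (intro allI impI)
  fix c :: "int \<Rightarrow> nat" and l u
  assume len: "u - l < n" and rf: "rainbow_free c {l..u}"
  show "card (c ` {l..u}) \<le> k + 1"
  proof (cases "card (c ` {l..u}) \<ge> 2")
    case True
    from extremal_subinterval[OF this] obtain p q where pq: "l \<le> p" "p < q" "q \<le> u" "c ` {p..q} = c ` {l..u}"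
      "\<And>x. \<lbrakk>p < x; x \<le> q\<rbrakk> \<Longrightarrow> c x \<noteq> c p" "\<And>x. \<lbrakk>p \<le> x; x < q\<rbrakk> \<Longrightarrow> c x \<noteq> c q"
      by blast
    have rf': "rainbow_free c {p..q}" using rainbow_free_subset[OF rf] pq by auto
    obtain m where m: "m \<ge> 1" "q = p + 2 * m - 1"
      "c ` {p..q} = insert (c q) (c ` {p..p + m - 1})"
      by (rule colors_of_left_half[OF rf' pq(2) pq(5,6)]) blast+
    have "max_colors_le m k" using assms
      by (rule max_colors_le_mono) (use m pq len in auto)
    then show ?thesis using card_le_left_half[OF rf' _ m(2,1,3)] pq(4) by simp
  qed simp
qed

text \<open>
  Up to translation to \<open>{1..16}\<close>, the unique endpoint colors force the classes \<open>{8,12,14,15}\<close>,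
  \<open>{2,3,5,9}\<close>, \<open>{4,7,10,13}\<close>, \<open>{6,11}\<close> to be monochromatic, and any three of these classes contain
  a transversal progression. Hence the interior has at most two colors.
\<close>
lemma card_colors_16:
  fixes c :: "int \<Rightarrow> nat"
  assumes rf: "rainbow_free c {p..p + 15}"
    and p: "\<And>x. \<lbrakk>p < x; x \<le> p + 15\<rbrakk> \<Longrightarrow> c x \<noteq> c p"
    and q: "\<And>x. \<lbrakk>p \<le> x; x < p + 15\<rbrakk> \<Longrightarrow> c x \<noteq> c (p + 15)"
  shows "card (c ` {p..p + 15}) \<le> 4"
proof -
  \<comment> \<open>Progressions starting at \<open>p\<close>: its unique color forces the other two
    terms to agree.\<close>
  have L: "c (p + i) = c (p + 2 * i)" if "1 \<le> i" "i \<le> 7" for i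
  proof -
    have "c p = c (p + i) \<or> c (p + i) = c (p + 2 * i) \<or> c p = c (p + 2 * i)"
      using that by (intro rainbow_freeD[OF rf]) auto
    then show ?thesis using p[of "p + i"] p[of "p + 2 * i"] that by auto
  qed
  \<comment> \<open>The mirror image, with \<open>p + 15\<close> as last term.\<close>
  have R: "c (p + i) = c (p + 2 * i - 15)" if "8 \<le> i" "i \<le> 14" for i
  proof -
    have "c (p + 2 * i - 15) = c (p + i) \<or> c (p + i) = c (p + 15) \<or>
        c (p + 2 * i - 15) = c (p + 15)"
      using that by (intro rainbow_freeD[OF rf]) auto
    then show ?thesis using q[of "p + i"] q[of "p + 2 * i - 15"] that by auto
  qed
  \<comment> \<open>One representative per forced class; offset \<open>i\<close> from
    \<open>p\<close> is the point \<open>i + 1\<close> of \<open>{1..16}\<close>.\<close>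
  define A B C D where "A = c (p + 7)" and "B = c (p + 1)" and "C = c (p + 3)" and "D = c (p + 5)"
  have cls: "c (p + 2) = B" "c (p + 4) = B" "c (p + 8) = B" "c (p + 6) = C" "c (p + 12) = C"
    "c (p + 9) = C" "c (p + 10) = D" "c (p + 14) = A" "c (p + 13) = A" "c (p + 11) = A"
    using L[of 1] L[of 2] L[of 3] L[of 4] L[of 5] L[of 6] L[of 7] R[of 9] R[of 13] R[of 14]
    by (simp_all add: A_def B_def C_def D_def add.commute)
  \<comment> \<open>One transversal progression for each of the four triples of classes; together
    they leave at most two values.\<close>
  have "B = C \<or> C = D \<or> B = D"
    using rainbow_freeD[OF rf, of "p + 1" "p + 5" "p + 3"] by (simp add: B_def C_def D_def)
  moreover have "C = D \<or> D = A \<or> C = A"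
    using rainbow_freeD[OF rf, of "p + 3" "p + 7" "p + 5"] by (simp add: A_def C_def D_def)
  moreover have "C = A \<or> A = B \<or> C = B"
    using rainbow_freeD[OF rf, of "p + 6" "p + 8" "p + 7"] cls by (simp add: A_def)
  moreover have "B = A \<or> A = D \<or> B = D"
    using rainbow_freeD[OF rf, of "p + 4" "p + 10" "p + 7"] cls by (simp add: A_def)
  ultimately obtain X Y where XY: "{A, B, C, D} \<subseteq> {X, Y}" by auto
  have "{p..p + 15} = (\<lambda>i. p + i) ` {0..15}" by simp
  also have "{0..15} = {0, 1, 2, 3, 4, 5, 6, 7, 8, 9, 10, 11, 12, 13, 14, 15::int}"
    unfolding set_upto[symmetric] by (simp add: upto_rec1 del: set_upto)
  finally have "c ` {p..p + 15} = {c p, c (p + 15), A, B, C, D}"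
    by (auto simp: cls A_def[symmetric] B_def[symmetric] C_def[symmetric] D_def[symmetric])
  also have "\<dots> \<subseteq> set [c p, c (p + 15), X, Y]" using XY by auto
  finally have "card (c ` {p..p + 15}) \<le> card (set [c p, c (p + 15), X, Y])"
    by (intro card_mono) auto
  also have "\<dots> \<le> 4" using card_length[of "[c p, c (p + 15), X, Y]"] by simp
  finally show ?thesis .
qed

section \<open>Color bounds for particular lengths and for powers of two\<close>

lemma max_colors_le_3: "max_colors_le 3 2"
  using max_colors_le_double[of 3 1] max_colors_le_1 by (simp add: numeral_2_eq_2)

lemma max_colors_le_7: "max_colors_le 7 3"
  using max_colors_le_double[of 7 2] max_colors_le_3 by simp

lemma max_colors_le_8: "max_colors_le 8 4"
  by (rule max_colors_le_mono[of 15])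
    (use max_colors_le_double[of 15 3] max_colors_le_7 in simp_all)

text \<open>Doubling from length 8 would give 5. Doubling from 7 settles all lengths up to 15, so
  only an extremal subinterval of length exactly 16 needs the class argument.\<close>

lemma max_colors_le_16: "max_colors_le 16 4"
  unfolding max_colors_le_def
proof (intro allI impI)
  fix c :: "int \<Rightarrow> nat" and l u :: int
  assume len: "u - l < 16" and rf: "rainbow_free c {l..u}"
  show "card (c ` {l..u}) \<le> 4"
  proof (cases "card (c ` {l..u}) \<ge> 2")
    case True
    from extremal_subinterval[OF this] obtain p q where pq: "l \<le> p" "p < q" "q \<le> u" "c ` {p..q} = c ` {l..u}"
      "\<And>x. \<lbrakk>p < x; x \<le> q\<rbrakk> \<Longrightarrow> c x \<noteq> c p" "\<And>x. \<lbrakk>p \<le> x; x < q\<rbrakk> \<Longrightarrow> c x \<noteq> c q"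
      by blast
    have rf': "rainbow_free c {p..q}" using rainbow_free_subset[OF rf] pq by auto
    show ?thesis
    proof (cases "q = p + 15")
      case True
      then show ?thesis using card_colors_16[of c p] rf' pq by auto
    next
      case False
      then have "card (c ` {p..q}) \<le> 3 + 1"
        using max_colors_le_double[of 15 3] max_colors_le_7 len pq
        by (intro max_colors_leD[OF _ rf']) auto
      then show ?thesis using pq(4) by simp
    qed
  qed simp
qed

text \<open>The induction starts at \<open>k = 4\<close> since the claim fails for
  \<open>k = 3\<close>: length 8 admits four colors.\<close>

lemma max_colors_le_power2: "k \<ge> 4 \<Longrightarrow> max_colors_le (2 ^ k) k"
proof (induction k rule: dec_induct)
  case base
  then show ?case using max_colors_le_16 by simp
next
  case (step k)
  then show ?case using max_colors_le_double[of "2 ^ Suc k" k] by simp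
qed

lemma aw_3_upper:
  fixes n :: int
  assumes "max_colors_le m k" "3 \<le> n" "n \<le> m"
  shows "aw {1..n} 3 \<le> k + 1"
  using assms by (intro aw_3_le max_colors_leD[OF assms(1)]) auto

section \<open>Ceilings of logarithms and the final bounds\<close>

lemma ceiling_log_eq:
  fixes n :: int
  assumes "b \<ge> 2" "int b ^ t < n" "n \<le> int b ^ (t + 1)"
  shows "\<lceil>log (real b) (real_of_int n)\<rceil> = int t + 1"
proof -
  have "real b ^ t < real_of_int n" "real_of_int n \<le> real b ^ (t + 1)"
    using assms(2,3) by (simp_all add: of_int_less_iff[symmetric, where 'a=real]
      of_int_le_iff[symmetric, where 'a=real] del: of_int_less_iff of_int_le_iff)
  moreover from this have "real_of_int n > 0" using assms(1)
    by (meson less_trans of_nat_0_less_iff order_less_le_trans pos2 zero_less_power)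
  ultimately show ?thesis using assms(1)
    by (intro ceiling_unique)
      (auto simp: less_log_iff log_le_iff powr_realpow powr_add mult.commute)
qed

lemma between_powers:
  fixes n :: int and b :: nat
  assumes "b \<ge> 2" "n \<ge> 2"
  obtains t where "int b ^ t < n" "n \<le> int b ^ (t + 1)"
proof -
  define t where "t = (LEAST t. n \<le> int b ^ (t + 1))"
  \<comment> \<open>Some exponent works because \<open>b ^ m\<close> exceeds \<open>m\<close>, so
    the \<open>LEAST\<close> defining \<open>t\<close> is attained.\<close>
  have "nat n < b ^ nat n" using assms power_gt_expt[of b "nat n"] by simp
  then have "n < int b ^ nat n" using assms by (simp add: nat_less_iff)
  also have "\<dots> \<le> int b ^ (nat n + 1)" using assms by (intro power_increasing) auto
  finally have "n \<le> int b ^ (nat n + 1)" by simp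
  then have le: "n \<le> int b ^ (t + 1)" unfolding t_def by (rule LeastI)
  moreover have "int b ^ t < n"
  proof (cases t)
    case (Suc s)
    then have "\<not> n \<le> int b ^ (s + 1)"
      using not_less_Least[of s "\<lambda>t. n \<le> int b ^ (t + 1)"] by (simp add: t_def)
    then show ?thesis using Suc by simp
  qed (use assms in simp)
  ultimately show ?thesis using that by blast
qed

theorem theorem1p1:
  "(\<forall>n::int. n \<ge> 9 \<longrightarrow>
      \<lceil>log 3 (real_of_int n)\<rceil> + 2 \<le> int (aw {1..n} 3) \<and>
      int (aw {1..n} 3) \<le> \<lceil>log 2 (real_of_int n)\<rceil> + 1) \<and>
   (\<forall>n::int. n \<in> {3, 4, 5, 6, 7} \<longrightarrow>
      int (aw {1..n} 3) = \<lceil>log 3 (real_of_int n)\<rceil> + 2) \<and>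
   aw {1..8} 3 = 5"
proof (intro conjI allI impI)
  fix n :: int assume n: "n \<ge> 9"
  obtain t where t: "int 3 ^ t < n" "n \<le> int 3 ^ (t + 1)"
    using between_powers[of 3 n] n by auto
  then have "\<lceil>log 3 (real_of_int n)\<rceil> = int t + 1" using ceiling_log_eq[of 3 t n] by simp
  moreover have "t + 3 \<le> aw {1..n} 3" using aw_3_lower[of n t] t n by simp
  ultimately show "\<lceil>log 3 (real_of_int n)\<rceil> + 2 \<le> int (aw {1..n} 3)" by simp
next
  fix n :: int assume n: "n \<ge> 9"
  obtain t where t: "int 2 ^ t < n" "n \<le> int 2 ^ (t + 1)"
    using between_powers[of 2 n] n by auto
  \<comment> \<open>This places the exponent \<open>t + 1\<close> in the range where the
    power-of-two bound holds.\<close>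
  have "t \<ge> 3"
  proof (rule ccontr)
    assume "\<not> t \<ge> 3"
    then have "(2::int) ^ (t + 1) \<le> 2 ^ 3" by (intro power_increasing) auto
    then show False using t n by simp
  qed
  then have "max_colors_le (2 ^ (t + 1)) (t + 1)" by (intro max_colors_le_power2) simp
  then have "aw {1..n} 3 \<le> t + 1 + 1" by (rule aw_3_upper) (use t n in auto)
  moreover have "\<lceil>log 2 (real_of_int n)\<rceil> = int t + 1" using ceiling_log_eq[of 2 t n] t by simp
  ultimately show "int (aw {1..n} 3) \<le> \<lceil>log 2 (real_of_int n)\<rceil> + 1" by simp
next
  fix n :: int assume n: "n \<in> {3, 4, 5, 6, 7}"
  show "int (aw {1..n} 3) = \<lceil>log 3 (real_of_int n)\<rceil> + 2"
  \<comment> \<open>The ceiling is 1 at the power 3 itself and 2 for \<open>4\<close> to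
    \<open>7\<close>; the color bounds 2 and 3 for lengths 3 and 7 match.\<close>
  proof (cases "n = 3")
    case True
    then show ?thesis
      using aw_3_lower[of 3 0] aw_3_upper[OF max_colors_le_3, of 3] by simp
  next
    case False
    then have n4: "4 \<le> n" "n \<le> 7" using n by auto
    then have "\<lceil>log 3 (real_of_int n)\<rceil> = 2" using ceiling_log_eq[of 3 1 n] by simp
    then show ?thesis
      using aw_3_lower[of n 1] aw_3_upper[OF max_colors_le_7, of n] n4 by simp
  qed
next
  show "aw {1..8} 3 = 5" using five_le_aw_8 aw_3_upper[OF max_colors_le_8, of 8] by simp
qed

end
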